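(* Let $n\geq3$ and let $F$ be an analytic function defined in a neighbourhood of $0\in\mathbb{C}$, with $|F'|\neq1$ there, such that $F(0)=F''(0)=\dots=F^{(n-1)}(0)=0$ and $F'(0)\neq0$, $F^{(n)}(0)\neq0$. Let $K$ be the Gaussian curvature of the modular surface in $\mathbb{E}_1^3$ induced by $F$. Then $K(0)$ is undefined, but in a deleted neighbourhood of $z=0$ there are $n-1$ regions of positive Gaussian curvature, $n-1$ regions of negative Gaussian curvature, and $2n-2$ curves of zero Gaussian curvature emanating from the origin separating these regions.
   Context: $\mathbb{E}_1^3$ denotes $\mathbb{R}^3$ with the Lorentzian metric $dx^2+dy^2-dt^2$; $(x,y)$ is identified with $z=x+iy$. The modular surface induced by an analytic function $F$ is the graph $(x,y,h(x,y))$ with $h=|F|$. Its Gaussian curvature in $\mathbb{E}_1^3$, as a function of $z$, is $$K=-\frac{h_{xx}h_{yy}-h_{xy}^2}{(1-h_x^2-h_y^2)^2},$$ which where $F\neq0$ and $|F'|\neq1$ equals $-\dfrac{|F'|^4-|2FF''-(F')^2|^2}{4|F|^2(1-|F'|^2)^2}$; "$K(0)$ is undefined" is asserted on the basis of this last formula at a point where $F=0$. $F$ is not required to be the square of an analytic function. Regions and curves are understood as subsets of the $z$-plane (parameter domain). $F^{(k)}$ denotes the $k$-th complex derivative. *)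

theory Defs
  imports "HOL-Complex_Analysis.Complex_Analysis"
begin

text \<open>A function of \<open>(x, y)\<close> is regarded as a function of \<open>z = x + \<i>y\<close>.\<close>

definition x_line :: "(complex \<Rightarrow> real) \<Rightarrow> complex \<Rightarrow> real \<Rightarrow> real" where
  "x_line h z = (\<lambda>t. h (z + complex_of_real t))"

definition y_line :: "(complex \<Rightarrow> real) \<Rightarrow> complex \<Rightarrow> real \<Rightarrow> real" where
  "y_line h z = (\<lambda>t. h (z + \<i> * complex_of_real t))"

definition partial_x :: "(complex \<Rightarrow> real) \<Rightarrow> complex \<Rightarrow> real" where
  "partial_x h z = deriv (x_line h z) 0"

definition partial_y :: "(complex \<Rightarrow> real) \<Rightarrow> complex \<Rightarrow> real" where
  "partial_y h z = deriv (y_line h z) 0"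

text \<open>Gaussian curvature of the graph of \<open>h\<close> for the metric \<open>dx\<^sup>2 + dy\<^sup>2 - dt\<^sup>2\<close>. Since
  \<^const>\<open>deriv\<close> and division are total, the value is meaningful only where
  \<open>lorentz_curvature_defined\<close> below holds.\<close>

definition lorentz_curvature :: "(complex \<Rightarrow> real) \<Rightarrow> complex \<Rightarrow> real" where
  "lorentz_curvature h z =
     - (partial_x (partial_x h) z * partial_y (partial_y h) z - (partial_y (partial_x h) z)\<^sup>2) /
       (1 - (partial_x h z)\<^sup>2 - (partial_y h z)\<^sup>2)\<^sup>2"

text \<open>All derivatives occurring in the formula exist and its denominator does not vanish. The
  first partial derivatives have to exist near \<open>z\<close> for the second ones to make sense at \<open>z\<close>.\<close>

definition lorentz_curvature_defined :: "(complex \<Rightarrow> real) \<Rightarrow> complex \<Rightarrow> bool" where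
  "lorentz_curvature_defined h z \<longleftrightarrow>
     (\<forall>\<^sub>F w in nhds z. x_line h w differentiable at 0 \<and> y_line h w differentiable at 0) \<and>
     x_line (partial_x h) z differentiable at 0 \<and>
     y_line (partial_x h) z differentiable at 0 \<and>
     y_line (partial_y h) z differentiable at 0 \<and>
     1 - (partial_x h z)\<^sup>2 - (partial_y h z)\<^sup>2 \<noteq> 0"

definition modular_height :: "(complex \<Rightarrow> complex) \<Rightarrow> complex \<Rightarrow> real" where
  "modular_height F z = cmod (F z)"

text \<open>A simple curve in the deleted disc of radius \<open>r\<close> that starts at the origin and runs to the
  boundary circle; the two end points are not counted as part of the curve.\<close>

definition curve_from_origin :: "real \<Rightarrow> complex set \<Rightarrow> bool" where
  "curve_from_origin r C \<longleftrightarrow>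
     (\<exists>\<gamma>. arc \<gamma> \<and> pathstart \<gamma> = 0 \<and> pathfinish \<gamma> \<in> sphere 0 r \<and>
          \<gamma> ` {0<..<1} \<subseteq> ball 0 r \<and> C = \<gamma> ` {0<..<1})"

text \<open>The curves \<open>C 0, \<dots>, C (m - 1)\<close> separate the positive regions (the members of \<open>Pos\<close>) from the
  negative ones (the members of \<open>Neg\<close>) in \<open>D\<close>: the regions can be arranged in a cyclic order with
  alternating signs such that, inside \<open>D\<close>, the \<open>j\<close>-th region is bounded exactly by the \<open>j\<close>-th
  curve and its cyclic successor.\<close>

definition curves_separate ::
  "complex set \<Rightarrow> nat \<Rightarrow> (nat \<Rightarrow> complex set) \<Rightarrow> complex set set \<Rightarrow> complex set set \<Rightarrow> bool" where
  "curves_separate D m C Pos Neg \<longleftrightarrow>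
     (\<exists>R. bij_betw R {..<m} (Pos \<union> Neg) \<and>
        (\<forall>j<m. (even j \<longrightarrow> R j \<in> Pos) \<and> (odd j \<longrightarrow> R j \<in> Neg) \<and>
               D \<inter> frontier (R j) = C j \<union> C (Suc j mod m)))"

end

theory Submission
  imports Defs
begin

text \<open>
  Put \<open>L = F' / F\<close>. Since \<open>ln \<bar>F\<bar>\<close> is the real part of \<open>ln F\<close>, the partial derivatives of the
  height \<open>\<bar>F\<bar>\<close> are \<open>\<bar>F\<bar> Re L\<close> and \<open>- \<bar>F\<bar> Im L\<close>. Differentiating once more gives
  \<open>K = \<bar>F\<bar>\<^sup>2 (\<bar>L'\<bar>\<^sup>2 + Re (L' cnj (L\<^sup>2))) / (1 - \<bar>F'\<bar>\<^sup>2)\<^sup>2\<close> (\<open>curvature_modular_graph\<close>). As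
  \<open>L' + L\<^sup>2 = F'' / F\<close>, the bracket equals \<open>- Re q \<bar>L'\<bar>\<^sup>2\<close> for the analytic function
  \<open>q = F F'' / (F'\<^sup>2 - F F'')\<close>. So the sign of \<open>K\<close> is opposite to the sign of \<open>Re q\<close>
  (\<open>sgn_curvature_modular_graph\<close>).

  The hypotheses at the origin say that \<open>F\<close> vanishes there to order \<open>1\<close> and \<open>F''\<close> to order \<open>n - 2\<close>.
  Hence \<open>q\<close> has a zero of order exactly \<open>m = n - 1\<close> (\<open>local_power_form\<close>), and in a suitable
  coordinate \<open>K\<close> has the sign of \<open>- Re (w\<^sup>m)\<close>, whose zero set consists of \<open>2 m\<close> rays that
  separate \<open>2 m\<close> sectors of alternating sign.

  The conformal coordinate \<open>w = z exp (k z)\<close> with \<open>q = w\<^sup>m\<close> does not map round discs to round discs,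
  whereas the curves have to end on a circle in the \<open>z\<close>-plane. But only the argument of \<open>w\<close>
  matters for the sign, so \<open>w\<close> may be replaced by \<open>H z = z cis (Im (k z))\<close>, which preserves the
  modulus. On a small closed disc about the origin, \<open>H\<close> is a homeomorphism onto the same disc
  (\<open>twist_to_power\<close>). Pulling back the polar coordinates of the target along \<open>H\<close> yields the regions
  and the curves (\<open>alternating_sectors\<close>).

  At the origin itself the curvature is undefined because the height behaves there like
  \<open>\<bar>F'(0)\<bar> \<bar>z\<bar>\<close> and has no partial derivatives (\<open>cmod_not_differentiable_at_simple_zero\<close>).
\<close>

section \<open>The curvature of a modular graph\<close>

text \<open>Both coordinate directions are instances of one construction, so that every derivative is
  computed once, in an arbitrary direction \<open>e\<close>.\<close>
definition dir_line :: "complex \<Rightarrow> (complex \<Rightarrow> real) \<Rightarrow> complex \<Rightarrow> real \<Rightarrow> real" where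
  "dir_line e h z = (\<lambda>t. h (z + e * complex_of_real t))"

lemma x_line_eq: "x_line h z = dir_line 1 h z"
  and y_line_eq: "y_line h z = dir_line \<i> h z"
  by (simp_all add: x_line_def y_line_def dir_line_def)

lemma holomorphic_along_line:
  assumes "(f has_field_derivative f') (at z)"
  shows "((\<lambda>t. f (z + e * complex_of_real t)) has_vector_derivative e * f') (at 0)"
proof -
  have "((\<lambda>t::real. z + e * of_real t) has_vector_derivative e) (at 0)"
    by (auto intro!: derivative_eq_intros)
  moreover have "(f has_field_derivative f') (at (z + e * of_real 0) within range (\<lambda>t::real. z + e * of_real t))"
    using assms by (simp add: has_field_derivative_at_within)
  ultimately show ?thesis
    using field_vector_diff_chain_within[of "\<lambda>t::real. z + e * of_real t" e 0 UNIV f f']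
    by (simp add: o_def)
qed

text \<open>Formally, \<open>ln \<bar>f\<bar> = Re (ln f)\<close>, so the logarithmic derivative of \<open>\<bar>f\<bar>\<close> in direction \<open>e\<close> is
  the real part of \<open>e\<close> times the logarithmic derivative of \<open>f\<close>.\<close>
lemma cmod_along_line:
  assumes "(f has_field_derivative f') (at z)" "f z \<noteq> 0"
  shows "(dir_line e (modular_height f) z has_real_derivative cmod (f z) * Re (e * (f' / f z))) (at 0)"
proof -
  have "((\<lambda>t. f (z + e * complex_of_real t)) has_derivative (\<lambda>s. s *\<^sub>R (e * f'))) (at 0)"
    using holomorphic_along_line[OF assms(1)] by (simp add: has_vector_derivative_def)
  moreover have "(cmod has_derivative (\<lambda>v. v \<bullet> sgn (f z))) (at (f (z + e * complex_of_real 0)))"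
    using has_derivative_norm[of "f z"] assms(2) by simp
  ultimately have "((\<lambda>t. cmod (f (z + e * complex_of_real t))) has_derivative
        (\<lambda>s. (s *\<^sub>R (e * f')) \<bullet> sgn (f z))) (at 0)"
    by (rule has_derivative_compose)
  moreover have "(\<lambda>s. (s *\<^sub>R (e * f')) \<bullet> sgn (f z)) = (*) (cmod (f z) * Re (e * (f' / f z)))"
  proof
    fix s :: real
    have "(e * f') \<bullet> sgn (f z) = Re (e * f' * cnj (f z)) / cmod (f z)"
      by (simp add: inner_complex_def sgn_eq add_divide_distrib)
    also have "e * f' * cnj (f z) = of_real ((cmod (f z))\<^sup>2) * (e * (f' / f z))"
      unfolding complex_norm_square using assms(2) by simp
    also have "Re \<dots> = (cmod (f z))\<^sup>2 * Re (e * (f' / f z))"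
      by (simp del: of_real_power times_divide_eq_right)
    finally have "(e * f') \<bullet> sgn (f z) = cmod (f z) * Re (e * (f' / f z))"
      using assms(2) by (simp add: power2_eq_square)
    then show "(s *\<^sub>R (e * f')) \<bullet> sgn (f z) = cmod (f z) * Re (e * (f' / f z)) * s"
      by (simp only: inner_scaleR_left mult.commute)
  qed
  ultimately show ?thesis
    by (simp only: has_field_derivative_def dir_line_def modular_height_def)
qed

text \<open>At a simple zero the graph has a conical point: along the horizontal line the height behaves
  like \<open>\<bar>f'\<bar> \<bar>t\<bar>\<close>, whereas a derivative, being taken at a minimum, would have to vanish.\<close>
lemma cmod_not_differentiable_at_simple_zero:
  assumes "(f has_field_derivative f') (at z)" "f z = 0" "f' \<noteq> 0"
  shows "\<not> x_line (modular_height f) z differentiable at 0"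
proof
  assume "x_line (modular_height f) z differentiable at 0"
  then obtain d where d: "((\<lambda>t. cmod (f (z + of_real t))) has_real_derivative d) (at 0)"
    by (auto simp: x_line_def modular_height_def real_differentiable_def)
  have "d = 0"
    using d by (rule DERIV_local_min[of _ _ _ 1]) (auto simp: assms)
  have "((\<lambda>t. norm (cmod (f (z + of_real t)) / t)) \<longlongrightarrow> 0) (at 0)"
    using d \<open>d = 0\<close> assms(2) unfolding has_field_derivative_iff by (intro tendsto_norm_zero) simp
  moreover have "((\<lambda>t. norm (f (z + complex_of_real t) / complex_of_real t)) \<longlongrightarrow> norm f') (at 0)"
  proof (intro tendsto_norm)
    have "((\<lambda>h. f (z + h) / h) \<longlongrightarrow> f') (at 0)"
      using assms(1,2) by (simp add: DERIV_def)
    moreover have "filterlim complex_of_real (at 0) (at 0)"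
      by (auto simp: filterlim_at eventually_at_filter intro!: tendsto_eq_intros)
    ultimately show "((\<lambda>t. f (z + complex_of_real t) / complex_of_real t) \<longlongrightarrow> f') (at 0)"
      by (rule filterlim_compose)
  qed
  ultimately show False
    using assms(3) LIM_unique by (fastforce simp: norm_divide)
qed

text \<open>Writing \<open>f' = f L\<close> makes the first partial derivatives \<open>\<bar>f\<bar> Re (e L)\<close>, a product of two
  factors that are both easy to differentiate; this gives all second partial derivatives.\<close>
lemma dir_line_cmod_log_derivative:
  assumes f: "(f has_field_derivative f z * L z) (at z)" "f z \<noteq> 0"
    and L: "(L has_field_derivative L') (at z)"
  shows "(dir_line e' (\<lambda>w. cmod (f w) * Re (e * L w)) z has_real_derivative
     cmod (f z) * (Re (e' * L z) * Re (e * L z) + Re (e' * e * L'))) (at 0)"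
proof -
  have 1: "((\<lambda>t. cmod (f (z + e' * complex_of_real t))) has_real_derivative
      cmod (f z) * Re (e' * L z)) (at 0)"
    using cmod_along_line[OF f] f(2) by (simp add: dir_line_def modular_height_def)
  have "((\<lambda>w. e * L w) has_field_derivative e * L') (at z)"
    by (intro DERIV_cmult L)
  then have "((\<lambda>t. Re (e * L (z + e' * complex_of_real t))) has_real_derivative Re (e' * (e * L'))) (at 0)"
    unfolding has_real_derivative_iff_has_vector_derivative
    by (intro bounded_linear.has_vector_derivative[OF bounded_linear_Re] holomorphic_along_line)
  from DERIV_mult[OF 1 this] show ?thesis
    by (simp add: dir_line_def algebra_simps)
qed

lemma dir_line_cong:
  assumes "\<forall>\<^sub>F w in nhds z. g w = h w" "(dir_line e h z has_real_derivative d) (at 0)"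
  shows "(dir_line e g z has_real_derivative d) (at 0)"
proof -
  have "((\<lambda>t. z + e * complex_of_real t) \<longlongrightarrow> z) (nhds 0)"
    by (auto intro!: tendsto_eq_intros filterlim_ident)
  then have "\<forall>\<^sub>F t in nhds 0. g (z + e * complex_of_real t) = h (z + e * complex_of_real t)"
    using assms(1) by (rule eventually_compose_filterlim[rotated])
  with assms(2) show ?thesis
    unfolding dir_line_def by (subst DERIV_cong_ev) auto
qed

text \<open>In terms of \<open>L = F' / F = p + \<i>q\<close> and \<open>L' = s + \<i>t\<close>, the second partial derivatives of
  \<open>h = \<bar>F\<bar>\<close> are \<open>h (p\<^sup>2 + s)\<close>, \<open>- h (p q + t)\<close> and \<open>h (q\<^sup>2 - s)\<close>. In their Hessian determinant
  the terms \<open>p\<^sup>2 q\<^sup>2\<close> cancel, and what remains is minus \<open>h\<^sup>2\<close> times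
  \<open>\<bar>L'\<bar>\<^sup>2 + Re (L' cnj (L\<^sup>2))\<close>. The gradient has squared length \<open>\<bar>F L\<bar>\<^sup>2 = \<bar>F'\<bar>\<^sup>2\<close>.\<close>
proposition curvature_modular_graph:
  assumes S: "open S" "F holomorphic_on S" "z \<in> S" "\<And>w. w \<in> S \<Longrightarrow> F w \<noteq> 0"
    and "cmod (deriv F z) \<noteq> 1"
  defines "L \<equiv> (\<lambda>w. deriv F w / F w)"
  shows "lorentz_curvature_defined (modular_height F) z" (is ?defined)
    and "lorentz_curvature (modular_height F) z =
      (cmod (F z))\<^sup>2 * ((cmod (deriv L z))\<^sup>2 + Re (deriv L z * cnj ((L z)\<^sup>2))) /
      (1 - (cmod (deriv F z))\<^sup>2)\<^sup>2" (is ?formula)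
proof -
  let ?h = "modular_height F"
  define h where "h = cmod (F z)"
  define p where "p = Re (L z)"
  define q where "q = Im (L z)"
  define s where "s = Re (deriv L z)"
  define t where "t = Im (deriv L z)"
  have F': "(F has_field_derivative F w * L w) (at w)" if "w \<in> S" for w
    using holomorphic_derivI[OF S(2,1) that] S(4)[OF that] by (simp add: L_def)
  have "L holomorphic_on S"
    unfolding L_def using S by (intro holomorphic_intros) auto
  then have L': "(L has_field_derivative deriv L z) (at z)"
    using S by (intro holomorphic_derivI)
  have first: "(dir_line e ?h w has_real_derivative cmod (F w) * Re (e * L w)) (at 0)" if "w \<in> S" for e w
    using cmod_along_line[OF F'[OF that]] S(4)[OF that] by simp
  have second: "(dir_line e' (\<lambda>w. cmod (F w) * Re (e * L w)) z has_real_derivative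
      h * (Re (e' * L z) * Re (e * L z) + Re (e' * e * deriv L z))) (at 0)" for e e'
    unfolding h_def using F'[OF S(3)] S(4)[OF S(3)] L' by (rule dir_line_cmod_log_derivative)
  have px: "partial_x ?h w = cmod (F w) * Re (1 * L w)"
    and py: "partial_y ?h w = cmod (F w) * Re (\<i> * L w)" if "w \<in> S" for w
    using DERIV_imp_deriv[OF first[OF that]] by (simp_all add: partial_x_def partial_y_def x_line_eq y_line_eq)
  have near: "\<forall>\<^sub>F w in nhds z. w \<in> S"
    using S by (simp add: eventually_nhds_in_open)
  note nx = eventually_mono[OF near px] and ny = eventually_mono[OF near py]
  note xx = dir_line_cong[OF nx second[of 1 1]]
    and xy = dir_line_cong[OF nx second[of \<i> 1]]
    and yy = dir_line_cong[OF ny second[of \<i> \<i>]]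
  have "partial_x (partial_x ?h) z = h * (p\<^sup>2 + s)"
    "partial_y (partial_x ?h) z = - h * (q * p + t)"
    "partial_y (partial_y ?h) z = h * (q\<^sup>2 - s)"
    unfolding partial_x_def[of "partial_x ?h"] partial_y_def[of "partial_x ?h"]
      partial_y_def[of "partial_y ?h"] x_line_eq y_line_eq
    using DERIV_imp_deriv[OF xx] DERIV_imp_deriv[OF xy] DERIV_imp_deriv[OF yy]
    by (simp_all add: p_def q_def s_def t_def power2_eq_square algebra_simps)
  moreover have "(partial_x ?h z)\<^sup>2 + (partial_y ?h z)\<^sup>2 = (cmod (F z))\<^sup>2 * (cmod (L z))\<^sup>2"
    using S(3) by (simp add: px py cmod_power2 power_mult_distrib algebra_simps)
  moreover have "\<dots> = (cmod (deriv F z))\<^sup>2"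
    using S(3,4) by (simp add: L_def norm_divide power_divide)
  ultimately have second_partials:
    "partial_x (partial_x ?h) z = h * (p\<^sup>2 + s)"
    "partial_y (partial_x ?h) z = - h * (q * p + t)"
    "partial_y (partial_y ?h) z = h * (q\<^sup>2 - s)"
    and grad: "1 - (partial_x ?h z)\<^sup>2 - (partial_y ?h z)\<^sup>2 = 1 - (cmod (deriv F z))\<^sup>2"
    by simp_all
  have det: "partial_x (partial_x ?h) z * partial_y (partial_y ?h) z - (partial_y (partial_x ?h) z)\<^sup>2
       = h\<^sup>2 * ((p\<^sup>2 + s) * (q\<^sup>2 - s) - (q * p + t)\<^sup>2)"
    unfolding second_partials by (simp add: power2_eq_square algebra_simps)
  have "- ((p\<^sup>2 + s) * (q\<^sup>2 - s) - (q * p + t)\<^sup>2) = ((cmod (deriv L z))\<^sup>2 + Re (deriv L z * cnj ((L z)\<^sup>2)))"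
    unfolding cmod_power2 by (simp add: p_def q_def s_def t_def power2_eq_square algebra_simps)
  then show ?formula
    unfolding lorentz_curvature_def det grad h_def by (metis mult_minus_right)
  have "\<forall>\<^sub>F w in nhds z. x_line ?h w differentiable at 0 \<and> y_line ?h w differentiable at 0"
    using near by (rule eventually_mono) (use first in \<open>auto simp: x_line_eq y_line_eq real_differentiable_def\<close>)
  moreover have "1 - (cmod (deriv F z))\<^sup>2 \<noteq> 0"
    using assms(5) norm_ge_zero[of "deriv F z"] by (fastforce simp: power2_eq_1_iff simp del: norm_ge_zero)
  ultimately show ?defined
    unfolding lorentz_curvature_defined_def grad x_line_eq y_line_eq real_differentiable_def
    using xx xy yy by blast
qed

text \<open>With \<open>q = F F'' / (F'\<^sup>2 - F F'')\<close> one has \<open>L' + L\<^sup>2 = F'' / F = - q L'\<close>, so the bracket in the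
  curvature, the real part of \<open>cnj L' (L' + L\<^sup>2)\<close>, is \<open>- Re q \<bar>L'\<bar>\<^sup>2\<close>. The zero set of the
  curvature is therefore the preimage of a straight line under an analytic function, although in
  terms of \<open>F F'' / F'\<^sup>2\<close> it is the preimage of a circle.\<close>

lemma sgn_curvature_modular_graph:
  assumes S: "open S" "F holomorphic_on S" "z \<in> S" "\<And>w. w \<in> S \<Longrightarrow> F w \<noteq> 0"
    and "cmod (deriv F z) \<noteq> 1"
    and g: "(deriv F z)\<^sup>2 - F z * deriv (deriv F) z \<noteq> 0"
  shows "sgn (lorentz_curvature (modular_height F) z) =
    - sgn (Re (F z * deriv (deriv F) z / ((deriv F z)\<^sup>2 - F z * deriv (deriv F) z)))"
proof -
  define L where "L = (\<lambda>w. deriv F w / F w)"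
  define q where "q = F z * deriv (deriv F) z / ((deriv F z)\<^sup>2 - F z * deriv (deriv F) z)"
  have "(L has_field_derivative
      (deriv (deriv F) z * F z - deriv F z * deriv F z) / (F z * F z)) (at z)"
    unfolding L_def using S
    by (intro DERIV_divide holomorphic_derivI[of F S] holomorphic_derivI[of "deriv F" S] holomorphic_deriv) auto
  then have L': "deriv L z = - ((deriv F z)\<^sup>2 - F z * deriv (deriv F) z) / (F z)\<^sup>2"
    by (simp add: DERIV_imp_deriv power2_eq_square mult.commute)
  have Fz: "F z \<noteq> 0"
    using S by blast
  have "deriv L z + (L z)\<^sup>2 = - (q * deriv L z)"
    using Fz g unfolding L' q_def by (simp add: L_def field_simps power2_eq_square)
  then have "cnj (deriv L z) * deriv L z + cnj (deriv L z) * (L z)\<^sup>2 = - (q * (deriv L z * cnj (deriv L z)))"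
    by (metis (no_types, lifting) distrib_left mult.commute mult.left_commute mult_minus_right)
  from arg_cong[OF this, of Re]
  have "(cmod (deriv L z))\<^sup>2 + Re (deriv L z * cnj ((L z)\<^sup>2)) = - (Re q * (cmod (deriv L z))\<^sup>2)"
    unfolding complex_norm_square[symmetric] mult.commute[of "cnj (deriv L z)" "deriv L z"]
    by (simp del: complex_cnj_power)
  then have K: "lorentz_curvature (modular_height F) z = - (Re q *
      ((cmod (F z))\<^sup>2 * (cmod (deriv L z))\<^sup>2 / (1 - (cmod (deriv F z))\<^sup>2)\<^sup>2))"
    using curvature_modular_graph(2)[OF assms(1-5)] by (simp add: L_def)
  have "deriv L z \<noteq> 0"
    using Fz g by (simp add: L')
  moreover have "(cmod (deriv F z))\<^sup>2 \<noteq> 1"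
    using assms(5) norm_ge_zero[of "deriv F z"] by (fastforce simp: power2_eq_1_iff simp del: norm_ge_zero)
  ultimately have "(cmod (F z))\<^sup>2 * (cmod (deriv L z))\<^sup>2 / (1 - (cmod (deriv F z))\<^sup>2)\<^sup>2 > 0"
    using Fz by simp
  then show ?thesis
    unfolding K q_def[symmetric] sgn_minus sgn_mult[of "Re q"] by (simp only: sgn_pos mult_1_right)
qed

section \<open>Reduction to a power by a twist\<close>

text \<open>Since \<open>F\<close> vanishes to order \<open>1\<close> and \<open>F''\<close> to order \<open>n - 2\<close>, the product \<open>F F''\<close> has a zero
  of order exactly \<open>n - 1\<close>, while the denominator \<open>F'\<^sup>2 - F F''\<close> takes the value \<open>F'(0)\<^sup>2 \<noteq> 0\<close> at the
  origin.\<close>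

lemma local_power_form:
  assumes "n \<ge> 3" and S: "open S" "0 \<in> S" and F: "F holomorphic_on S" and "F 0 = 0"
    and vanish: "\<And>k. 2 \<le> k \<Longrightarrow> k \<le> n - 1 \<Longrightarrow> (deriv ^^ k) F 0 = 0"
    and F'0: "deriv F 0 \<noteq> 0" and Fn: "(deriv ^^ n) F 0 \<noteq> 0"
  obtains R p where "R > 0" "ball 0 R \<subseteq> S" "p holomorphic_on ball 0 R"
    "\<And>z. z \<in> ball 0 R \<Longrightarrow> p z \<noteq> 0"
    "\<And>z. z \<in> ball 0 R - {0} \<Longrightarrow> F z \<noteq> 0"
    "\<And>z. z \<in> ball 0 R \<Longrightarrow> (deriv F z)\<^sup>2 - F z * deriv (deriv F) z \<noteq> 0"
    "\<And>z. z \<in> ball 0 R \<Longrightarrow>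
       F z * deriv (deriv F) z / ((deriv F z)\<^sup>2 - F z * deriv (deriv F) z) = z ^ (n - 1) * p z"
proof -
  let ?F'' = "deriv (deriv F)"
  define g where "g = (\<lambda>w. (deriv F w)\<^sup>2 - F w * ?F'' w)"
  have F'': "?F'' holomorphic_on S"
    using F S by (intro holomorphic_deriv)
  have g: "g holomorphic_on S"
    unfolding g_def using F S by (intro holomorphic_intros F'') auto
  obtain f1 r1 where f1: "0 < r1" "f1 holomorphic_on ball 0 r1"
    "\<And>w. w \<in> ball 0 r1 \<Longrightarrow> F w - F 0 = (w - 0) ^ 1 * f1 w" "\<And>w. w \<in> ball 0 r1 \<Longrightarrow> f1 w \<noteq> 0"
    by (rule holomorphic_factor_order_of_zero[OF F S, of 1]) (use F'0 in auto)
  have shift: "(deriv ^^ k) ?F'' = (deriv ^^ (k + 2)) F" for k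
    by (simp add: funpow_swap1)
  have "n - 2 + 2 = n"
    using \<open>n \<ge> 3\<close> by simp
  then have F''_order: "(deriv ^^ (n - 2)) ?F'' 0 \<noteq> 0"
    using Fn by (metis shift)
  have F''_vanish: "(deriv ^^ i) ?F'' 0 = 0" if "i < n - 2" for i
    unfolding shift using that by (intro vanish) auto
  obtain f2 r2 where f2: "0 < r2" "f2 holomorphic_on ball 0 r2"
    "\<And>w. w \<in> ball 0 r2 \<Longrightarrow> ?F'' w - ?F'' 0 = (w - 0) ^ (n - 2) * f2 w" "\<And>w. w \<in> ball 0 r2 \<Longrightarrow> f2 w \<noteq> 0"
    by (rule holomorphic_factor_order_of_zero[OF F'' S, of "n - 2"])
      (use \<open>n \<ge> 3\<close> F''_order F''_vanish in auto)
  have F''0: "?F'' 0 = 0"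
    using F''_vanish[of 0] \<open>n \<ge> 3\<close> by simp
  have "g 0 \<noteq> 0"
    using F'0 \<open>F 0 = 0\<close> by (simp add: g_def)
  have "open (S \<inter> g -` (- {0}))"
    using holomorphic_on_imp_continuous_on[OF g] S(1) by (rule continuous_open_preimage) auto
  then obtain r3 where r3: "r3 > 0" "ball 0 r3 \<subseteq> S \<inter> g -` (- {0})"
    using S(2) \<open>g 0 \<noteq> 0\<close> by (metis (no_types, lifting) ComplI IntI open_contains_ball singletonD vimageI2)
  define R where "R = min r1 (min r2 r3)"
  define p where "p = (\<lambda>w. f1 w * f2 w / g w)"
  have R: "R > 0" and sub: "ball 0 R \<subseteq> ball (0::complex) r1" "ball 0 R \<subseteq> ball (0::complex) r2"
    "ball (0::complex) R \<subseteq> ball 0 r3"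
    using f1(1) f2(1) r3(1) by (auto simp: R_def)
  have g_nz: "g z \<noteq> 0" if "z \<in> ball 0 R" for z
    using r3(2) sub(3) that by auto
  have subS: "ball 0 R \<subseteq> S"
    using r3(2) sub(3) by blast
  have F_eq: "F w = w * f1 w" if "w \<in> ball 0 R" for w
    using f1(3)[of w] sub(1) that \<open>F 0 = 0\<close> by auto
  have F''_eq: "?F'' w = w ^ (n - 2) * f2 w" if "w \<in> ball 0 R" for w
    using f2(3)[of w] sub(2) that F''0 by auto
  show thesis
  proof (rule that)
    show "p holomorphic_on ball 0 R"
      unfolding p_def using f1(2) f2(2) g sub subS g_nz
      by (intro holomorphic_intros) (auto elim: holomorphic_on_subset)
    show "p z \<noteq> 0" if "z \<in> ball 0 R" for z
      using f1(4)[of z] f2(4)[of z] g_nz[OF that] sub that by (auto simp: p_def)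
    show "F z \<noteq> 0" if "z \<in> ball 0 R - {0}" for z
      using F_eq[of z] f1(4)[of z] sub that by auto
    show "(deriv F z)\<^sup>2 - F z * ?F'' z \<noteq> 0" if "z \<in> ball 0 R" for z
      using g_nz[OF that] by (simp add: g_def)
    show "F z * ?F'' z / ((deriv F z)\<^sup>2 - F z * ?F'' z) = z ^ (n - 1) * p z" if "z \<in> ball 0 R" for z
    proof -
      have "n - 1 = Suc (n - 2)"
        using \<open>n \<ge> 3\<close> by simp
      then have "F z * ?F'' z = z ^ (n - 1) * (f1 z * f2 z)"
        using F_eq[OF that] F''_eq[OF that] by simp
      then show ?thesis
        by (simp add: p_def g_def)
    qed
  qed (use R subS in auto)
qed

lemma norm_cis_diff_le: "cmod (cis a - cis b) \<le> \<bar>a - b\<bar>"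
proof -
  have "cis a - cis b = cis b * (exp (\<i> * of_real (a - b)) - 1)"
    unfolding cis_conv_exp[symmetric] by (simp add: right_diff_distrib cis_mult)
  then have "cmod (cis a - cis b) = 2 * \<bar>sin ((a - b) / 2)\<bar>"
    by (simp only: norm_mult dist_exp_i_1 norm_cis mult_1)
  also have "\<dots> \<le> \<bar>a - b\<bar>"
    using abs_sin_le_one abs_sin_x_le_abs_x[of "(a - b) / 2"] by simp
  finally show ?thesis .
qed

text \<open>The twist preserves every circle about the origin, and two points of a circle of radius at
  most \<open>r\<close> cannot be identified because \<open>\<alpha>\<close> turns them against each other by an angle that is too
  small: injectivity is a contraction estimate. Surjectivity is a fixed point problem, as \<open>w\<close> is the
  image of \<open>z\<close> exactly if \<open>z = w cis (- \<alpha> z)\<close>.\<close>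
lemma twist_homeomorphism:
  fixes \<alpha> :: "complex \<Rightarrow> real"
  assumes "r > 0" "continuous_on (cball 0 r) \<alpha>"
    and lip: "\<And>z w. z \<in> cball 0 r \<Longrightarrow> w \<in> cball 0 r \<Longrightarrow> \<bar>\<alpha> z - \<alpha> w\<bar> \<le> M * cmod (z - w)"
    and "r * M < 1"
  shows "\<exists>G. homeomorphism (cball 0 r) (cball 0 r) (\<lambda>z. z * cis (\<alpha> z)) G"
proof (rule homeomorphism_compact)
  let ?H = "\<lambda>z. z * cis (\<alpha> z)"
  show "continuous_on (cball 0 r) ?H"
    unfolding cis_conv_exp by (intro continuous_intros assms)
  show "inj_on ?H (cball 0 r)"
  proof (rule inj_onI, rule ccontr)
    fix z w assume z: "z \<in> cball 0 r" and w: "w \<in> cball 0 r" and eq: "?H z = ?H w" and "z \<noteq> w"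
    have norms: "cmod z = cmod w"
      using arg_cong[OF eq, of cmod] by (simp add: norm_mult)
    have "(z - w) * cis (\<alpha> z) = w * (cis (\<alpha> w) - cis (\<alpha> z))"
      using eq by (simp add: algebra_simps)
    then have "cmod (z - w) = cmod w * cmod (cis (\<alpha> w) - cis (\<alpha> z))"
      by (metis norm_mult norm_cis mult.right_neutral)
    also have "\<dots> \<le> r * (M * cmod (z - w))"
      using w lip[OF w z] norm_cis_diff_le[of "\<alpha> w" "\<alpha> z"] \<open>r > 0\<close>
      by (intro mult_mono) (auto simp: norm_minus_commute)
    also have "\<dots> < cmod (z - w)"
      using mult_strict_right_mono[OF \<open>r * M < 1\<close>, of "cmod (z - w)"] \<open>z \<noteq> w\<close> by (simp add: mult.assoc)
    finally show False by simp
  qed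
  show "?H ` cball 0 r = cball 0 r"
  proof (intro equalityI subsetI)
    fix w :: complex assume w: "w \<in> cball 0 r"
    obtain z where z: "z \<in> cball 0 r" "w * cis (- \<alpha> z) = z"
    proof (rule brouwer_ball[OF \<open>r > 0\<close>, of 0 "\<lambda>z. w * cis (- \<alpha> z)"])
      show "continuous_on (cball 0 r) (\<lambda>z. w * cis (- \<alpha> z))"
        unfolding cis_conv_exp by (intro continuous_intros assms)
    qed (use w in \<open>auto simp: norm_mult\<close>)
    then have "?H z = w * (cis (- \<alpha> z) * cis (\<alpha> z))"
      by (metis mult.assoc)
    then have "?H z = w"
      by (simp add: cis_mult)
    with z show "w \<in> ?H ` cball 0 r"
      by force
  qed (auto simp: norm_mult)
qed simp

lemma holomorphic_imp_local_lipschitz: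
  assumes "f holomorphic_on ball 0 R" "R > 0"
  obtains M where "M > 0" "\<And>z w. z \<in> cball 0 (R / 2) \<Longrightarrow> w \<in> cball 0 (R / 2) \<Longrightarrow>
     cmod (f z - f w) \<le> M * cmod (z - w)"
proof -
  have sub: "cball 0 (R / 2) \<subseteq> ball (0::complex) R"
    using assms(2) by auto
  have "continuous_on (cball 0 (R / 2)) (deriv f)"
    using holomorphic_on_imp_continuous_on[OF holomorphic_deriv[OF assms(1) open_ball]] sub
    by (rule continuous_on_subset)
  then have "bounded (deriv f ` cball 0 (R / 2))"
    by (intro compact_imp_bounded compact_continuous_image) auto
  then obtain M where M: "M > 0" "\<And>z. z \<in> cball 0 (R / 2) \<Longrightarrow> cmod (deriv f z) \<le> M"
    by (auto simp: bounded_pos)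
  moreover have "cmod (f z - f w) \<le> M * cmod (z - w)" if "z \<in> cball 0 (R / 2)" "w \<in> cball 0 (R / 2)" for z w
    using convex_cball _ M(2) that
  proof (rule field_differentiable_bound)
    show "(f has_field_derivative deriv f x) (at x within cball 0 (R / 2))" if "x \<in> cball 0 (R / 2)" for x
      using holomorphic_derivI[OF assms(1) open_ball] sub that by blast
  qed
  ultimately show thesis
    using that by blast
qed

text \<open>Near the origin \<open>z\<^sup>m p(z) = (z exp (k z))\<^sup>m\<close> for an analytic \<open>k\<close>. The factor \<open>exp (Re k)\<close>
  scales by a positive real number and does not affect the sign of the real part of the power.
  Dropping it turns the conformal coordinate \<open>z exp k\<close> into the twist \<open>z cis (Im k)\<close>, which maps
  every disc about the origin to itself: the round disc in the \<open>z\<close>-plane then corresponds to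
  a round disc in the new coordinate.\<close>
proposition twist_to_power:
  assumes p: "p holomorphic_on ball 0 R" "R > 0" "\<And>z. z \<in> ball 0 R \<Longrightarrow> p z \<noteq> 0" and "m > 0"
  obtains r H G where "0 < r" "r < R" "homeomorphism (cball 0 r) (cball 0 r) H G"
    "\<And>z. cmod (H z) = cmod z"
    "\<And>z. z \<in> cball 0 r \<Longrightarrow> sgn (Re (z ^ m * p z)) = sgn (Re (H z ^ m))"
proof -
  obtain l where l: "l holomorphic_on ball 0 R" "\<And>z. z \<in> ball 0 R \<Longrightarrow> exp (l z) = p z"
    using holomorphic_logarithm_exists[OF convex_ball open_ball p(1,3), of 0] \<open>R > 0\<close> by auto
  define k where "k = (\<lambda>z. l z / of_nat m)"
  have k: "k holomorphic_on ball 0 R"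
    unfolding k_def using \<open>m > 0\<close> by (intro holomorphic_intros l) auto
  have exp_k: "exp (k z) ^ m = p z" if "z \<in> ball 0 R" for z
    using l(2)[OF that] \<open>m > 0\<close> by (simp add: k_def flip: exp_of_nat_mult)
  obtain M where M: "M > 0" "\<And>z w. z \<in> cball 0 (R / 2) \<Longrightarrow> w \<in> cball 0 (R / 2) \<Longrightarrow>
     cmod (k z - k w) \<le> M * cmod (z - w)"
    using holomorphic_imp_local_lipschitz[OF k p(2)] by blast
  \<comment> \<open>The bound \<open>1 / (2 M)\<close> makes \<open>r * M < 1\<close>, as the twist requires.\<close>
  define r where "r = min (R / 2) (1 / (2 * M))"
  have r: "0 < r" "r \<le> R / 2" "r < R" "r * M < 1"
    using M(1) p(2) by (auto simp: r_def field_simps min_def)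
  have sub: "cball 0 r \<subseteq> cball (0::complex) (R / 2)" "cball 0 r \<subseteq> ball (0::complex) R"
    using r p(2) by auto
  define H where "H = (\<lambda>z. z * cis (Im (k z)))"
  have "continuous_on (cball 0 r) (\<lambda>z. Im (k z))"
    using holomorphic_on_imp_continuous_on[OF k] sub(2)
    by (intro continuous_intros) (rule continuous_on_subset)
  moreover have "\<bar>Im (k z) - Im (k w)\<bar> \<le> M * cmod (z - w)" if "z \<in> cball 0 r" "w \<in> cball 0 r" for z w
    using M(2)[of z w] abs_Im_le_cmod[of "k z - k w"] that sub(1) by (simp add: subset_iff)
  ultimately obtain G where "homeomorphism (cball 0 r) (cball 0 r) H G"
    unfolding H_def using twist_homeomorphism[OF r(1) _ _ r(4)] by blast
  moreover have "cmod (H z) = cmod z" for z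
    by (simp add: H_def norm_mult)
  moreover have "sgn (Re (z ^ m * p z)) = sgn (Re (H z ^ m))" if "z \<in> cball 0 r" for z
  proof -
    have "z ^ m * p z = (z * exp (k z)) ^ m"
      using exp_k[of z] that sub(2) by (auto simp: power_mult_distrib)
    also have "z * exp (k z) = of_real (exp (Re (k z))) * H z"
      by (simp add: H_def exp_eq_polar mult_ac)
    also have "Re (\<dots> ^ m) = exp (Re (k z)) ^ m * Re (H z ^ m)"
      by (simp add: power_mult_distrib del: of_real_power flip: of_real_power)
    finally show ?thesis
      by (simp add: sgn_mult)
  qed
  ultimately show thesis
    using that r by blast
qed

section \<open>Sectors in curved polar coordinates\<close>

text \<open>A connected set covered by disjoint open sets lies in one of them, so no member of the family
  can be enlarged to a bigger connected subset of the union.\<close>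
lemma components_Union_disjoint_open:
  assumes "\<And>A. A \<in> \<A> \<Longrightarrow> open A \<and> connected A \<and> A \<noteq> {}"
    and disj: "\<And>A B. A \<in> \<A> \<Longrightarrow> B \<in> \<A> \<Longrightarrow> A \<noteq> B \<Longrightarrow> A \<inter> B = {}"
  shows "components (\<Union>\<A>) = \<A>"
proof
  show sup: "\<A> \<subseteq> components (\<Union>\<A>)"
  proof
    fix A assume A: "A \<in> \<A>"
    have "T = A" if T: "A \<subseteq> T" "T \<subseteq> \<Union>\<A>" "connected T" for T
    proof -
      have "A \<inter> T = {} \<or> \<Union>(\<A> - {A}) \<inter> T = {}"
      proof (rule connectedD[OF T(3)])
        show "open A" "open (\<Union>(\<A> - {A}))"
          using assms(1) A by auto
        show "A \<inter> \<Union>(\<A> - {A}) \<inter> T = {}"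
          using disj[OF A] by blast
        show "T \<subseteq> A \<union> \<Union>(\<A> - {A})"
          using T(2) by blast
      qed
      then show ?thesis
        using assms(1)[OF A] T by blast
    qed
    then show "A \<in> components (\<Union>\<A>)"
      unfolding in_components_maximal using assms(1)[OF A] A by blast
  qed
  show "components (\<Union>\<A>) \<subseteq> \<A>"
  proof
    fix C assume C: "C \<in> components (\<Union>\<A>)"
    then obtain A where "A \<in> \<A>" "C \<inter> A \<noteq> {}"
      using in_components_nonempty[OF C] in_components_subset[OF C] by blast
    with C sup show "C \<in> \<A>"
      using components_eq by blast
  qed
qed

lemma rcis_eq_imp:
  assumes "rcis \<rho> \<theta> = rcis \<rho>' \<theta>'" "\<rho> > 0" "\<rho>' > 0" "\<bar>\<theta> - \<theta>'\<bar> < 2 * pi"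
  shows "\<rho> = \<rho>'" "\<theta> = \<theta>'"
proof -
  show eq: "\<rho> = \<rho>'"
    using arg_cong[OF assms(1), of cmod] assms(2,3) by simp
  have "cis \<theta> = cis \<theta>'"
    using assms(1,2) eq by (simp add: rcis_def)
  then obtain n :: int where n: "\<theta> = \<theta>' + 2 * pi * n"
    using sin_cos_eq_iff[of \<theta> \<theta>'] by (auto simp: cis.code complex_eq_iff)
  then have "\<bar>real_of_int n\<bar> < 1"
    using assms(4) by (simp add: abs_mult)
  then show "\<theta> = \<theta>'"
    using n by simp
qed

lemma Re_rcis_power: "Re (rcis \<rho> \<theta> ^ m) = \<rho> ^ m * cos (real m * \<theta>)"
  by (simp add: DeMoivre2)

text \<open>The directions in which \<open>Re (w\<^sup>m) = 0\<close>; those with \<open>j < 2 * m\<close> represent each direction once.\<close>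
definition zero_angle :: "nat \<Rightarrow> nat \<Rightarrow> real" where
  "zero_angle m j = (real j + 1 / 2) * pi / real m"

lemma cos_zero_angle:
  assumes "m > 0"
  shows "cos (real m * zero_angle m j) = 0"
proof -
  have "real m * zero_angle m j = real j * pi + pi / 2"
    using assms by (simp add: zero_angle_def field_simps)
  then show ?thesis
    by (simp add: cos_add)
qed

lemma sgn_cos_between_zero_angles:
  assumes "m > 0" "zero_angle m j < \<theta>" "\<theta> < zero_angle m (Suc j)"
  shows "sgn (cos (real m * \<theta>)) = (- 1) ^ Suc j"
proof -
  define y where "y = real m * \<theta> - real (Suc j) * pi"
  have "- (pi / 2) < y" "y < pi / 2"
    using assms by (simp_all add: y_def zero_angle_def field_simps)
  then have "cos y > 0"
    by (rule cos_gt_zero_pi)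
  have "cos (real m * \<theta>) = cos (real (Suc j) * pi + y)"
    by (simp add: y_def)
  also have "\<dots> = (- 1) ^ Suc j * cos y"
    by (simp only: cos_add cos_npi sin_npi mult_zero_left diff_zero)
  finally show ?thesis
    using \<open>cos y > 0\<close> by (simp add: sgn_mult minus_one_power_iff)
qed

lemma zero_angle_mono:
  assumes "m > 0" "i \<le> j"
  shows "zero_angle m i \<le> zero_angle m j"
  using assms by (auto simp: zero_angle_def divide_right_mono mult_right_mono)

lemma zero_angle_full_turn: "m > 0 \<Longrightarrow> zero_angle m (2 * m) = zero_angle m 0 + 2 * pi"
  by (simp add: zero_angle_def field_simps)

lemma zero_angle_less_Suc: "m > 0 \<Longrightarrow> zero_angle m j < zero_angle m (Suc j)"
  by (simp add: zero_angle_def divide_strict_right_mono mult_strict_right_mono)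

lemma zero_angle_inj: "m > 0 \<Longrightarrow> zero_angle m i = zero_angle m j \<longleftrightarrow> i = j"
  by (simp add: zero_angle_def)

lemma zero_angle_gap:
  assumes "m > 0" "i < 2 * m" "j < 2 * m"
  shows "\<bar>zero_angle m i - zero_angle m j\<bar> < 2 * pi"
  using zero_angle_mono[OF assms(1), of 0 i] zero_angle_mono[OF assms(1), of 0 j]
    zero_angle_mono[OF assms(1), of "Suc i" "2 * m"] zero_angle_mono[OF assms(1), of "Suc j" "2 * m"]
    zero_angle_less_Suc[OF assms(1), of i] zero_angle_less_Suc[OF assms(1), of j]
    zero_angle_full_turn[OF assms(1)] assms by linarith

text \<open>The index is the integer part of \<open>(m / \<pi>) Arg w - 1 / 2\<close>, reduced modulo the number \<open>2 * m\<close>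
  of sectors in a full turn; the quotient of this reduction is the number of full turns by which the
  argument is shifted.\<close>
lemma obtain_angle_sector:
  assumes "m > 0"
  obtains j \<theta> where "j < 2 * m" "zero_angle m j \<le> \<theta>" "\<theta> < zero_angle m (Suc j)"
    "rcis (cmod w) \<theta> = w"
proof -
  define x where "x = real m * Arg w / pi - 1 / 2"
  define k where "k = \<lfloor>x\<rfloor>"
  define d where "d = k div (2 * int m)"
  define j where "j = nat (k mod (2 * int m))"
  define \<theta> where "\<theta> = Arg w - 2 * pi * d"
  have j: "int j = k - 2 * int m * d"
    using assms by (simp add: j_def d_def minus_mult_div_eq_mod)
  have "j < 2 * m"
    using assms by (simp add: j_def nat_less_iff)
  moreover have x: "real m * \<theta> / pi - 1 / 2 = x - 2 * real m * d"
    using assms by (simp add: x_def \<theta>_def field_simps)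
  have "real_of_int k \<le> x" "x < real_of_int k + 1"
    by (simp_all add: k_def)
  moreover have "real j = real_of_int k - 2 * real m * d"
    using arg_cong[OF j, of real_of_int] by simp
  ultimately have "real j \<le> real m * \<theta> / pi - 1 / 2" "real m * \<theta> / pi - 1 / 2 < real j + 1"
    using x by linarith+
  then have "zero_angle m j \<le> \<theta>" "\<theta> < zero_angle m (Suc j)"
    using assms by (simp_all add: zero_angle_def field_simps)
  moreover have "rcis (cmod w) \<theta> = w"
  proof -
    have "cis \<theta> = cis (Arg w)"
      using sin_cos_eq_iff[of "Arg w" \<theta>] by (auto simp: \<theta>_def complex_eq_iff)
    then show ?thesis
      using rcis_cmod_Arg[of w] by (simp add: rcis_def)
  qed
  ultimately show thesis
    using that \<open>j < 2 * m\<close> by blast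
qed

lemma card_even_below: "card {j \<in> {..<2 * m}. even j} = m"
proof -
  have "{j \<in> {..<2 * m}. even j} = (\<lambda>i. 2 * i) ` {..<m}"
    by (auto elim!: evenE)
  then show ?thesis
    by (simp add: card_image inj_on_def)
qed

lemma card_odd_below: "card {j \<in> {..<2 * m}. odd j} = m"
proof -
  have "{j \<in> {..<2 * m}. odd j} = (\<lambda>i. 2 * i + 1) ` {..<m}"
    by (auto elim!: oddE)
  then show ?thesis
    by (simp add: card_image inj_on_def)
qed

text \<open>A homeomorphism of a disc that preserves every circle about the origin carries the polar
  coordinates of the target back to the source. Its rays and sectors are curved, but they meet every
  circle about the origin just as straight ones do.\<close>
locale norm_preserving_disc =
  fixes r :: real and H G :: "complex \<Rightarrow> complex"
  assumes r_pos: "r > 0"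
    and homeo: "homeomorphism (cball 0 r) (cball 0 r) H G"
    and norm_H: "\<And>z. z \<in> cball 0 r \<Longrightarrow> cmod (H z) = cmod z"
begin

definition polar :: "real \<Rightarrow> real \<Rightarrow> complex" where
  "polar \<rho> \<theta> = G (rcis \<rho> \<theta>)"

definition ray :: "real \<Rightarrow> complex set" where
  "ray \<theta> = (\<lambda>\<rho>. polar \<rho> \<theta>) ` {0<..<r}"

definition sector :: "real \<Rightarrow> real \<Rightarrow> complex set" where
  "sector a b = (\<lambda>(\<rho>, \<theta>). polar \<rho> \<theta>) ` ({0<..<r} \<times> {a<..<b})"

lemma H_polar: "0 \<le> \<rho> \<Longrightarrow> \<rho> \<le> r \<Longrightarrow> H (polar \<rho> \<theta>) = rcis \<rho> \<theta>"
  using homeo by (simp add: polar_def homeomorphism_def)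

lemma norm_polar: "0 \<le> \<rho> \<Longrightarrow> \<rho> \<le> r \<Longrightarrow> cmod (polar \<rho> \<theta>) = \<rho>"
proof -
  assume \<rho>: "0 \<le> \<rho>" "\<rho> \<le> r"
  then have "polar \<rho> \<theta> \<in> cball 0 r"
    using homeo by (auto simp: polar_def homeomorphism_def)
  then show ?thesis
    using norm_H H_polar[OF \<rho>, of \<theta>] \<rho> by fastforce
qed

lemma polar_eq_imp:
  assumes "polar \<rho> \<theta> = polar \<rho>' \<theta>'" "\<rho> \<in> {0<..r}" "\<rho>' \<in> {0<..r}" "\<bar>\<theta> - \<theta>'\<bar> < 2 * pi"
  shows "\<rho> = \<rho>' \<and> \<theta> = \<theta>'"
  using rcis_eq_imp[of \<rho> \<theta> \<rho>' \<theta>'] assms H_polar[of \<rho> \<theta>] H_polar[of \<rho>' \<theta>'] by auto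

lemma polar_of_H: "z \<in> cball 0 r \<Longrightarrow> rcis (cmod z) \<theta> = H z \<Longrightarrow> polar (cmod z) \<theta> = z"
  using homeo by (simp add: polar_def homeomorphism_def)

lemma continuous_on_polar:
  "continuous_on ({0..r} \<times> UNIV) (\<lambda>(\<rho>, \<theta>). polar \<rho> \<theta>)"
proof -
  have "continuous_on ({0..r} \<times> UNIV) (\<lambda>x. rcis (fst x) (snd x))"
    unfolding rcis_def cis_conv_exp by (intro continuous_intros)
  then have "continuous_on ({0..r} \<times> UNIV) (\<lambda>x. G (rcis (fst x) (snd x)))"
    using homeo by (rule_tac continuous_on_compose2[of "cball 0 r" G]) (auto simp: homeomorphism_def)
  then show ?thesis
    by (simp add: polar_def case_prod_beta)
qed

lemma polar_in_ray: "\<rho> \<in> {0<..<r} \<Longrightarrow> polar \<rho> \<theta> \<in> ray \<theta>"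
  unfolding ray_def by blast

lemma polar_in_sector: "\<rho> \<in> {0<..<r} \<Longrightarrow> \<theta> \<in> {a<..<b} \<Longrightarrow> polar \<rho> \<theta> \<in> sector a b"
  unfolding sector_def by (metis (no_types, lifting) SigmaI case_prod_conv image_eqI)

lemma connected_sector: "connected (sector a b)"
  unfolding sector_def
proof (intro connected_continuous_image connected_Times)
  show "continuous_on ({0<..<r} \<times> {a<..<b}) (\<lambda>(\<rho>, \<theta>). polar \<rho> \<theta>)"
    using continuous_on_polar by (rule continuous_on_subset) auto
qed auto

text \<open>Curved polar coordinates are continuous and injective on an open box of angular width at most
  a full turn, so openness is invariance of domain.\<close>
lemma open_sector:
  assumes "b - a \<le> 2 * pi"
  shows "open (sector a b)"
  unfolding sector_def
proof (rule invariance_of_domain_gen)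
  show "continuous_on ({0<..<r} \<times> {a<..<b}) (\<lambda>(\<rho>, \<theta>). polar \<rho> \<theta>)"
    using continuous_on_polar by (rule continuous_on_subset) auto
  show "inj_on (\<lambda>(\<rho>, \<theta>). polar \<rho> \<theta>) ({0<..<r} \<times> {a<..<b})"
    using assms by (auto intro!: inj_onI dest!: polar_eq_imp)
qed (auto intro: open_Times)

text \<open>The image of the closed box is compact, and by continuity it is contained in the closure of
  the image of the open box.\<close>
lemma closure_sector:
  assumes "a < b"
  shows "closure (sector a b) = (\<lambda>(\<rho>, \<theta>). polar \<rho> \<theta>) ` ({0..r} \<times> {a..b})" (is "_ = ?P ` ?B")
proof
  have cont: "continuous_on ?B ?P"
    using continuous_on_polar by (rule continuous_on_subset) auto
  then have "closed (?P ` ?B)"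
    by (intro compact_imp_closed compact_continuous_image compact_Times) auto
  then show "closure (sector a b) \<subseteq> ?P ` ?B"
    by (intro closure_minimal) (auto simp: sector_def)
  have box: "closure ({0<..<r} \<times> {a<..<b}) = ?B"
    using r_pos assms by (simp add: closure_Times)
  show "?P ` ?B \<subseteq> closure (sector a b)"
    using image_closure_subset[of "{0<..<r} \<times> {a<..<b}" ?P "closure (sector a b)"] cont
    by (simp add: box sector_def closure_subset)
qed

lemma in_punctured_disc_polar:
  assumes "0 \<le> \<rho>" "\<rho> \<le> r"
  shows "polar \<rho> \<theta> \<in> ball 0 r - {0} \<longleftrightarrow> 0 < \<rho> \<and> \<rho> < r"
proof -
  have "w \<in> ball 0 r - {0} \<longleftrightarrow> 0 < cmod w \<and> cmod w < r" for w
    by auto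
  then show ?thesis
    by (simp only: norm_polar[OF assms])
qed

lemma frontier_sector:
  assumes "a < b" "b - a < 2 * pi"
  shows "(ball 0 r - {0}) \<inter> frontier (sector a b) = ray a \<union> ray b" (is "?D \<inter> _ = _")
proof -
  have front: "frontier (sector a b) = closure (sector a b) - sector a b"
    using assms by (simp add: frontier_def interior_open open_sector)
  show ?thesis
    unfolding front closure_sector[OF assms(1)]
  proof (intro equalityI subsetI)
    fix z assume z: "z \<in> ?D \<inter> ((\<lambda>(\<rho>, \<theta>). polar \<rho> \<theta>) ` ({0..r} \<times> {a..b}) - sector a b)"
    then obtain \<rho> \<theta> where \<rho>: "0 \<le> \<rho>" "\<rho> \<le> r" "a \<le> \<theta>" "\<theta> \<le> b" "z = polar \<rho> \<theta>"
      by auto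
    then have "0 < \<rho>" "\<rho> < r"
      using in_punctured_disc_polar[of \<rho> \<theta>] z by auto
    moreover have "\<theta> = a \<or> \<theta> = b"
    proof (rule ccontr)
      assume "\<not> (\<theta> = a \<or> \<theta> = b)"
      then have "z \<in> sector a b"
        using \<rho> \<open>0 < \<rho>\<close> \<open>\<rho> < r\<close> by (simp add: polar_in_sector)
      with z show False by blast
    qed
    ultimately show "z \<in> ray a \<union> ray b"
      using \<rho>(5) polar_in_ray[of \<rho>] by auto
  next
    fix z assume "z \<in> ray a \<union> ray b"
    then obtain \<rho> \<theta> where \<rho>: "0 < \<rho>" "\<rho> < r" "\<theta> = a \<or> \<theta> = b" "z = polar \<rho> \<theta>"
      unfolding ray_def by fastforce
    have "z \<notin> sector a b"
    proof
      assume "z \<in> sector a b"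
      then obtain \<rho>' \<theta>' where "0 < \<rho>'" "\<rho>' < r" "a < \<theta>'" "\<theta>' < b" "polar \<rho> \<theta> = polar \<rho>' \<theta>'"
        using \<rho>(4) by (auto simp: sector_def)
      then show False
        using polar_eq_imp[of \<rho> \<theta> \<rho>' \<theta>'] \<rho>(1-3) assms by auto
    qed
    moreover have "z \<in> ?D"
      using in_punctured_disc_polar[of \<rho> \<theta>] \<rho> by simp
    moreover have "z \<in> (\<lambda>(\<rho>, \<theta>). polar \<rho> \<theta>) ` ({0..r} \<times> {a..b})"
      using \<rho> assms(1) by force
    ultimately show "z \<in> ?D \<inter> ((\<lambda>(\<rho>, \<theta>). polar \<rho> \<theta>) ` ({0..r} \<times> {a..b}) - sector a b)"
      by blast
  qed
qed

lemma curve_from_origin_ray: "curve_from_origin r (ray \<theta>)"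
  unfolding curve_from_origin_def
proof (intro exI conjI)
  let ?\<gamma> = "\<lambda>t. polar (r * t) \<theta>"
  have bounds: "0 \<le> r * t \<and> r * t \<le> r" if "t \<in> {0..1}" for t
    using r_pos that by (simp add: mult_left_le)
  have norm: "cmod (?\<gamma> t) = r * t" if "t \<in> {0..1}" for t
    using norm_polar bounds[OF that] by blast
  show "arc ?\<gamma>"
    unfolding arc_def path_def
  proof
    have "continuous_on {0..1} (\<lambda>t. (\<lambda>(\<rho>, \<theta>). polar \<rho> \<theta>) (r * t, \<theta>))"
      by (rule continuous_on_compose2[OF continuous_on_polar]) (use bounds in \<open>auto intro!: continuous_intros\<close>)
    then show "continuous_on {0..1} ?\<gamma>"
      by simp
    show "inj_on ?\<gamma> {0..1}"
    proof (rule inj_onI)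
      fix s t assume st: "s \<in> {0..1}" "t \<in> {0..1}" and eq: "?\<gamma> s = ?\<gamma> t"
      have "r * s = r * t"
        using arg_cong[OF eq, of cmod] norm[OF st(1)] norm[OF st(2)] by (rule box_equals)
      then show "s = t"
        using r_pos by simp
    qed
  qed
  show "pathstart ?\<gamma> = 0"
    using norm[of 0] by (simp add: pathstart_def)
  show "pathfinish ?\<gamma> \<in> sphere 0 r"
    using norm[of 1] by (simp add: pathfinish_def)
  show "?\<gamma> ` {0<..<1} \<subseteq> ball 0 r"
    using norm r_pos by auto
  have dilation: "(*) r ` {0<..<1} = {0<..<r}"
  proof (intro equalityI subsetI)
    fix \<rho> assume "\<rho> \<in> {0<..<r}"
    then show "\<rho> \<in> (*) r ` {0<..<1}"
      using r_pos by (intro image_eqI[of _ _ "\<rho> / r"]) auto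
  qed (use r_pos in auto)
  show "ray \<theta> = ?\<gamma> ` {0<..<1}"
    unfolding ray_def dilation[symmetric] image_image ..
qed

lemma ray_periodic: "ray (\<theta> + 2 * pi) = ray \<theta>"
  by (simp add: ray_def polar_def rcis_def flip: cis_mult)

lemma sector_nonempty: "a < b \<Longrightarrow> sector a b \<noteq> {}"
  using r_pos by (auto simp: sector_def)

lemma Re_power_on_ray:
  assumes "m > 0" "z \<in> ray (zero_angle m j)"
  shows "z \<in> ball 0 r - {0}" "Re (H z ^ m) = 0"
proof -
  obtain \<rho> where \<rho>: "0 < \<rho>" "\<rho> < r" "z = polar \<rho> (zero_angle m j)"
    using assms(2) by (auto simp: ray_def)
  then show "z \<in> ball 0 r - {0}" "Re (H z ^ m) = 0"
    using in_punctured_disc_polar[of \<rho>] cos_zero_angle[OF assms(1)]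
    by (simp_all add: H_polar Re_rcis_power)
qed

lemma sgn_Re_power_on_sector:
  assumes "m > 0" "z \<in> sector (zero_angle m j) (zero_angle m (Suc j))"
  shows "z \<in> ball 0 r - {0}" "sgn (Re (H z ^ m)) = (- 1) ^ Suc j"
proof -
  obtain \<rho> \<theta> where \<rho>: "0 < \<rho>" "\<rho> < r" "z = polar \<rho> \<theta>"
    and \<theta>: "zero_angle m j < \<theta>" "\<theta> < zero_angle m (Suc j)"
    using assms(2) by (auto simp: sector_def)
  then show "z \<in> ball 0 r - {0}" "sgn (Re (H z ^ m)) = (- 1) ^ Suc j"
    using in_punctured_disc_polar[of \<rho>] sgn_cos_between_zero_angles[OF assms(1) \<theta>]
    by (simp_all add: H_polar Re_rcis_power sgn_mult)
qed

lemma punctured_disc_cases: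
  assumes "m > 0" "z \<in> ball 0 r - {0}"
  obtains (ray) j where "j < 2 * m" "z \<in> ray (zero_angle m j)"
    | (sector) j where "j < 2 * m" "z \<in> sector (zero_angle m j) (zero_angle m (Suc j))"
proof -
  have z: "z \<in> cball 0 r" "0 < cmod z" "cmod z < r"
    using assms(2) by auto
  obtain j \<theta> where j: "j < 2 * m" "zero_angle m j \<le> \<theta>" "\<theta> < zero_angle m (Suc j)"
    "rcis (cmod z) \<theta> = H z"
    using obtain_angle_sector[OF assms(1), of "H z"] norm_H[OF z(1)] by metis
  have eq: "polar (cmod z) \<theta> = z"
    using z(1) j(4) by (rule polar_of_H)
  show thesis
  proof (cases "\<theta> = zero_angle m j")
    case True
    have "z \<in> ray (zero_angle m j)"
      using polar_in_ray[of "cmod z" \<theta>] z(2,3) eq True by simp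
    with j(1) show thesis by (rule that(1))
  next
    case False
    then have "\<theta> \<in> {zero_angle m j<..<zero_angle m (Suc j)}"
      using j(2,3) by simp
    then have "z \<in> sector (zero_angle m j) (zero_angle m (Suc j))"
      using polar_in_sector[of "cmod z" \<theta>] z(2,3) unfolding eq by simp
    with j(1) show thesis by (rule that(2))
  qed
qed

lemma disjoint_rays:
  assumes "m > 0"
  shows "disjoint_family_on (\<lambda>j. ray (zero_angle m j)) {..<2 * m}"
  unfolding disjoint_family_on_def
proof (intro ballI impI equals0I)
  fix i j z assume ij: "i \<in> {..<2 * m}" "j \<in> {..<2 * m}" "i \<noteq> j"
    and "z \<in> ray (zero_angle m i) \<inter> ray (zero_angle m j)"
  then obtain \<rho> \<rho>' where "\<rho> \<in> {0<..<r}" "\<rho>' \<in> {0<..<r}"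
    "polar \<rho> (zero_angle m i) = polar \<rho>' (zero_angle m j)"
    by (auto simp: ray_def)
  then show False
    using polar_eq_imp[of \<rho> "zero_angle m i" \<rho>' "zero_angle m j"] ij
      zero_angle_gap[OF assms, of i j] zero_angle_inj[OF assms, of i j] by auto
qed

lemma disjoint_sectors:
  assumes "m > 0" "i < 2 * m" "j < 2 * m" "i \<noteq> j"
  shows "sector (zero_angle m i) (zero_angle m (Suc i)) \<inter> sector (zero_angle m j) (zero_angle m (Suc j)) = {}"
proof (rule equals0I)
  fix z assume z: "z \<in> sector (zero_angle m i) (zero_angle m (Suc i)) \<inter> sector (zero_angle m j) (zero_angle m (Suc j))"
  then obtain \<rho> \<theta> \<rho>' \<theta>' where *: "\<rho> \<in> {0<..<r}" "\<rho>' \<in> {0<..<r}" "polar \<rho> \<theta> = polar \<rho>' \<theta>'"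
      "zero_angle m i < \<theta>" "\<theta> < zero_angle m (Suc i)" "zero_angle m j < \<theta>'" "\<theta>' < zero_angle m (Suc j)"
    by (auto simp: sector_def)
  have "\<bar>\<theta> - \<theta>'\<bar> < 2 * pi"
    using zero_angle_mono[OF assms(1), of 0 i] zero_angle_mono[OF assms(1), of 0 j]
      zero_angle_mono[OF assms(1), of "Suc i" "2 * m"] zero_angle_mono[OF assms(1), of "Suc j" "2 * m"]
      zero_angle_full_turn[OF assms(1)] assms * by linarith
  with * have "\<theta> = \<theta>'"
    using polar_eq_imp[of \<rho> \<theta> \<rho>' \<theta>'] by auto
  moreover have "Suc i \<le> j \<or> Suc j \<le> i"
    using assms(4) by linarith
  ultimately show False
    using zero_angle_mono[OF assms(1), of "Suc i" j] zero_angle_mono[OF assms(1), of "Suc j" i] * by linarith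
qed

text \<open>Between two consecutive zero directions \<open>Re (H\<^sup>m)\<close> has the sign \<open>(- 1)\<^bsup>j + 1\<^esup>\<close>, and \<open>K\<close> has
  the opposite one. The open sectors are connected and disjoint, so the sectors of even and of odd
  index are exactly the components of the two sign sets, and the curved rays bound them.\<close>
proposition alternating_sectors:
  assumes "m > 0"
    and K: "\<And>z. z \<in> ball 0 r - {0} \<Longrightarrow> sgn (K z) = - sgn (Re (H z ^ m))"
  defines "D \<equiv> ball 0 r - {0}" and "C \<equiv> \<lambda>j. ray (zero_angle m j)"
  shows "card (components {z \<in> D. K z > 0}) = m"
    and "card (components {z \<in> D. K z < 0}) = m"
    and "disjoint_family_on C {..<2 * m}"
    and "(\<Union>j<2 * m. C j) = {z \<in> D. K z = 0}"
    and "curves_separate D (2 * m) C (components {z \<in> D. K z > 0}) (components {z \<in> D. K z < 0})"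
proof -
  define R where "R = (\<lambda>j. sector (zero_angle m j) (zero_angle m (Suc j)))"
  let ?J = "{..<2 * m}"
  have sgn_R: "sgn (K z) = (- 1) ^ j" and R_D: "z \<in> D" if "z \<in> R j" for z j
    using sgn_Re_power_on_sector[OF assms(1), of z j] that K[of z] by (auto simp: R_def D_def)
  have K_C: "K z = 0" and C_D: "z \<in> D" if "z \<in> C j" for z j
    using Re_power_on_ray[OF assms(1), of z j] that K[of z] by (auto simp: C_def D_def sgn_0_0)
  have cases: "\<exists>j<2 * m. z \<in> C j \<or> z \<in> R j" if "z \<in> D" for z
    using punctured_disc_cases[OF assms(1), of z] that unfolding C_def R_def D_def by metis
  have pos_iff: "K z > 0 \<longleftrightarrow> even j" and neg_iff: "K z < 0 \<longleftrightarrow> odd j" if "z \<in> R j" for z j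
    using sgn_R[OF that] by (cases "even j"; auto simp: sgn_if split: if_splits)+
  have zero: "K z = 0 \<longleftrightarrow> (\<exists>j\<in>?J. z \<in> C j)"
    and positive: "K z > 0 \<longleftrightarrow> (\<exists>j\<in>?J. even j \<and> z \<in> R j)"
    and negative: "K z < 0 \<longleftrightarrow> (\<exists>j\<in>?J. odd j \<and> z \<in> R j)" if z: "z \<in> D" for z
  proof -
    obtain j where "j \<in> ?J" "z \<in> C j \<or> z \<in> R j"
      using cases[OF z] by blast
    then have *: "K z = 0 \<Longrightarrow> z \<in> C j" "K z > 0 \<Longrightarrow> even j \<and> z \<in> R j" "K z < 0 \<Longrightarrow> odd j \<and> z \<in> R j"
      using K_C[of z j] pos_iff[of z j] neg_iff[of z j] by (force, force, force)
    show "K z = 0 \<longleftrightarrow> (\<exists>j\<in>?J. z \<in> C j)"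
      using *(1) \<open>j \<in> ?J\<close> K_C by blast
    show "K z > 0 \<longleftrightarrow> (\<exists>j\<in>?J. even j \<and> z \<in> R j)"
      using *(2) \<open>j \<in> ?J\<close> pos_iff by blast
    show "K z < 0 \<longleftrightarrow> (\<exists>j\<in>?J. odd j \<and> z \<in> R j)"
      using *(3) \<open>j \<in> ?J\<close> neg_iff by blast
  qed
  have K_sets: "{z \<in> D. K z > 0} = \<Union>(R ` {j \<in> ?J. even j})" "{z \<in> D. K z < 0} = \<Union>(R ` {j \<in> ?J. odd j})"
    by (auto simp: positive negative intro: R_D pos_iff[THEN iffD2] neg_iff[THEN iffD2])
  show "(\<Union>j<2 * m. C j) = {z \<in> D. K z = 0}"
    by (auto simp: zero intro: C_D K_C)
  show "disjoint_family_on C {..<2 * m}"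
    unfolding C_def using assms(1) by (rule disjoint_rays)
  have gap: "zero_angle m j < zero_angle m (Suc j)" "zero_angle m (Suc j) - zero_angle m j < 2 * pi" for j
    using assms(1) by (simp_all add: zero_angle_def field_simps)
  have R: "open (R j) \<and> connected (R j) \<and> R j \<noteq> {}" for j
    unfolding R_def using gap[of j] by (auto simp: open_sector connected_sector sector_nonempty)
  have R_disj: "R i \<inter> R j = {}" if "i < 2 * m" "j < 2 * m" "i \<noteq> j" for i j
    unfolding R_def using assms(1) that by (rule disjoint_sectors)
  then have inj: "inj_on R ?J"
    using R by (intro inj_onI) (rule ccontr, fastforce)
  have comp: "components (\<Union>(R ` I)) = R ` I" if "I \<subseteq> ?J" for I
  proof (rule components_Union_disjoint_open)
    show "open A \<and> connected A \<and> A \<noteq> {}" if "A \<in> R ` I" for A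
      using that R by blast
    show "A \<inter> B = {}" if AB: "A \<in> R ` I" "B \<in> R ` I" "A \<noteq> B" for A B
    proof -
      obtain i j where "A = R i" "B = R j" "i \<in> I" "j \<in> I"
        using AB(1,2) by blast
      then show ?thesis
        using R_disj[of i j] \<open>I \<subseteq> ?J\<close> \<open>A \<noteq> B\<close> by auto
    qed
  qed
  have comps: "components {z \<in> D. K z > 0} = R ` {j \<in> ?J. even j}"
    "components {z \<in> D. K z < 0} = R ` {j \<in> ?J. odd j}"
    unfolding K_sets by (rule comp, blast)+
  have "card {j \<in> ?J. even j} = m" "card {j \<in> ?J. odd j} = m"
    by (rule card_even_below card_odd_below)+
  moreover have "inj_on R {j \<in> ?J. even j}" "inj_on R {j \<in> ?J. odd j}"
    using inj by (auto intro: inj_on_subset)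
  ultimately show "card (components {z \<in> D. K z > 0}) = m" "card (components {z \<in> D. K z < 0}) = m"
    by (simp_all add: comps card_image)
  show "curves_separate D (2 * m) C (components {z \<in> D. K z > 0}) (components {z \<in> D. K z < 0})"
    unfolding curves_separate_def comps
  proof (intro exI conjI allI impI)
    have "R ` {j \<in> ?J. even j} \<union> R ` {j \<in> ?J. odd j} = R ` ?J"
      by blast
    with inj show "bij_betw R ?J (R ` {j \<in> ?J. even j} \<union> R ` {j \<in> ?J. odd j})"
      by (simp add: bij_betw_def)
    fix j assume j: "j < 2 * m"
    show "R j \<in> R ` {j \<in> ?J. even j}" if "even j" using j that by blast
    show "R j \<in> R ` {j \<in> ?J. odd j}" if "odd j" using j that by blast
    \<comment> \<open>The last sector ends at the ray where the first one begins, one full turn later.\<close>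
    have "ray (zero_angle m (Suc j)) = C (Suc j mod (2 * m))"
    proof (cases "Suc j = 2 * m")
      case True
      then show ?thesis
        using zero_angle_full_turn[OF assms(1)] ray_periodic[of "zero_angle m 0"] by (simp add: C_def)
    qed (use j in \<open>simp add: C_def\<close>)
    then show "D \<inter> frontier (R j) = C j \<union> C (Suc j mod (2 * m))"
      unfolding R_def D_def using frontier_sector[OF gap[of j]] by (simp add: C_def)
  qed
qed

end

section \<open>The sign pattern around a simple zero\<close>

theorem proposition3p2:
  fixes n :: nat and F :: "complex \<Rightarrow> complex" and S :: "complex set"
    and K :: "complex \<Rightarrow> real"
  assumes "n \<ge> 3"
    and "open S" and "0 \<in> S" and "F analytic_on S"
    and "\<And>z. z \<in> S \<Longrightarrow> cmod (deriv F z) \<noteq> 1"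
    and "F 0 = 0" and "\<And>k. 2 \<le> k \<Longrightarrow> k \<le> n - 1 \<Longrightarrow> (deriv ^^ k) F 0 = 0"
    and "deriv F 0 \<noteq> 0" and "(deriv ^^ n) F 0 \<noteq> 0"
    and K_def: "K = lorentz_curvature (modular_height F)"
  shows "\<not> lorentz_curvature_defined (modular_height F) 0 \<and>
    (\<exists>r>0. ball 0 r \<subseteq> S \<and>
      (let D = ball 0 r - {0};
           Pos = components {z \<in> D. K z > 0};
           Neg = components {z \<in> D. K z < 0}
       in (\<forall>z\<in>D. lorentz_curvature_defined (modular_height F) z) \<and>
          card Pos = n - 1 \<and> card Neg = n - 1 \<and>
          (\<exists>C. (\<forall>j<2 * n - 2. curve_from_origin r (C j)) \<and>
               disjoint_family_on C {..<2 * n - 2} \<and>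
               (\<Union>j<2 * n - 2. C j) = {z \<in> D. K z = 0} \<and>
               curves_separate D (2 * n - 2) C Pos Neg)))"
proof
  have F: "F holomorphic_on S"
    using assms(4) by (rule analytic_imp_holomorphic)
  have "\<not> x_line (modular_height F) 0 differentiable at 0"
    using holomorphic_derivI[OF F assms(2,3)] assms(6,8) by (rule cmod_not_differentiable_at_simple_zero)
  then show "\<not> lorentz_curvature_defined (modular_height F) 0"
    unfolding lorentz_curvature_defined_def using eventually_nhds_x_imp_x by blast
  define m where "m = n - 1"
  have m: "m > 0" "2 * n - 2 = 2 * m"
    using assms(1) by (auto simp: m_def)
  obtain R p where R: "R > 0" "ball 0 R \<subseteq> S" and p: "p holomorphic_on ball 0 R"
    "\<And>z. z \<in> ball 0 R \<Longrightarrow> p z \<noteq> 0"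
    and Fnz: "\<And>z. z \<in> ball 0 R - {0} \<Longrightarrow> F z \<noteq> 0"
    and g: "\<And>z. z \<in> ball 0 R \<Longrightarrow> (deriv F z)\<^sup>2 - F z * deriv (deriv F) z \<noteq> 0"
    and q: "\<And>z. z \<in> ball 0 R \<Longrightarrow>
       F z * deriv (deriv F) z / ((deriv F z)\<^sup>2 - F z * deriv (deriv F) z) = z ^ m * p z"
    unfolding m_def using local_power_form[OF assms(1-3) F assms(6-9)] by blast
  obtain r H G where r: "0 < r" "r < R" and homeo: "homeomorphism (cball 0 r) (cball 0 r) H G"
    and norm_H: "\<And>z. cmod (H z) = cmod z"
    and H: "\<And>z. z \<in> cball 0 r \<Longrightarrow> sgn (Re (z ^ m * p z)) = sgn (Re (H z ^ m))"
    using twist_to_power[OF p(1) R(1) p(2) m(1)] by blast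
  interpret norm_preserving_disc r H G
    using r(1) homeo norm_H by unfold_locales
  define D where "D = ball (0::complex) r - {0}"
  have T: "open (ball 0 R - {0})" "F holomorphic_on ball 0 R - {0}"
    using F R(2) by (auto intro: holomorphic_on_subset)
  have D: "z \<in> ball 0 R - {0}" "z \<in> ball 0 R" "z \<in> cball 0 r" if "z \<in> D" for z
    using that r by (auto simp: D_def)
  have F'_D: "cmod (deriv F z) \<noteq> 1" if "z \<in> D" for z
    using D(2)[OF that] R(2) assms(5) by blast
  have defined: "\<forall>z\<in>D. lorentz_curvature_defined (modular_height F) z"
    using curvature_modular_graph(1)[OF T D(1) Fnz F'_D] by blast
  have sgn_K: "sgn (K z) = - sgn (Re (H z ^ m))" if "z \<in> D" for z
    using sgn_curvature_modular_graph[OF T D(1)[OF that] Fnz F'_D[OF that] g[OF D(2)[OF that]]]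
    unfolding K_def q[OF D(2)[OF that]] H[OF D(3)[OF that]] .
  note pattern = alternating_sectors[OF m(1) sgn_K[unfolded D_def], folded D_def]
  have "ball 0 r \<subseteq> S"
    using r R(2) by auto
  moreover have "\<forall>j<2 * m. curve_from_origin r (ray (zero_angle m j))"
    by (simp add: curve_from_origin_ray)
  moreover note r(1) defined pattern
  ultimately show "\<exists>r>0. ball 0 r \<subseteq> S \<and>
      (let D = ball 0 r - {0};
           Pos = components {z \<in> D. K z > 0};
           Neg = components {z \<in> D. K z < 0}
       in (\<forall>z\<in>D. lorentz_curvature_defined (modular_height F) z) \<and>
          card Pos = n - 1 \<and> card Neg = n - 1 \<and>
          (\<exists>C. (\<forall>j<2 * n - 2. curve_from_origin r (C j)) \<and>
               disjoint_family_on C {..<2 * n - 2} \<and>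
               (\<Union>j<2 * n - 2. C j) = {z \<in> D. K z = 0} \<and>
               curves_separate D (2 * n - 2) C Pos Neg))"
    unfolding Let_def m(2) m_def[symmetric] D_def
    by (intro exI[of _ r] conjI exI[of _ "\<lambda>j. ray (zero_angle m j)"])
qed

end
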